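(* Let $(\mathcal S,U,P)$ be a BCL triple with associated BCL pair $(M_{\phi_1},M_{\phi_2})$ on $H^2_{\mathcal S}(\mathbb T)$, and let $A:=UP^\perp UPU^*P^\perp U^*-P$, $B:=UP^\perp UPU^*PU^*$, $D:=UPUPU^*PU^*$. Then $H(M_{\phi_1},M_{\phi_2})\geq 0$ if and only if $A\geq 0$, $D\geq 0$ and $|\langle Bs,s\rangle|^2\le\langle As,s\rangle\langle Ds,s\rangle$ for all $s\in\mathcal S$.
   Context: A BCL triple $(\mathcal S,U,P)$ consists of a complex separable Hilbert space $\mathcal S$, a unitary $U$ on $\mathcal S$ and an orthogonal projection $P$ on $\mathcal S$; $P^\perp=I-P$. $H^2(\mathbb T)$ is the Hardy space of the circle, $S_z$ is multiplication by $z$ on it, and $H^2_{\mathcal S}(\mathbb T)$ ($\mathcal S$-valued Hardy space) is identified with $H^2(\mathbb T)\otimes\mathcal S$. The BCL pair is the commuting pair of isometries $M_{\phi_1}=I\otimes PU^*+S_z\otimes P^\perp U^*$, $M_{\phi_2}=I\otimes UP^\perp+S_z\otimes UP$. For commuting isometries $(V_1,V_2)$, $H(V_1,V_2):=V_2V_2^*-V_1V_1^*-V_2^2V_2^{*2}+V_1V_2V_1^*V_2^*$. *)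

theory Defs
  imports "HOL-Probability.Probability_Measure"
begin

section \<open>Complex Hilbert spaces\<close>

text \<open>
  The inner product is linear in the first argument.  Its real part is the library's real inner
  product, so that \<open>norm x = sqrt (Re (cinner x x))\<close> and all the library's notions for real
  inner product spaces apply.
\<close>

class complex_inner = real_inner +
  fixes scaleC :: "complex \<Rightarrow> 'a \<Rightarrow> 'a" (infixr "*\<^sub>C" 75)
    and cinner :: "'a \<Rightarrow> 'a \<Rightarrow> complex"
  assumes scaleC_add_right: "c *\<^sub>C (x + y) = c *\<^sub>C x + c *\<^sub>C y"
    and scaleC_add_left: "(c + d) *\<^sub>C x = c *\<^sub>C x + d *\<^sub>C x"
    and scaleC_scaleC: "c *\<^sub>C d *\<^sub>C x = (c * d) *\<^sub>C x"
    and scaleR_scaleC: "r *\<^sub>R x = complex_of_real r *\<^sub>C x"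
    and cinner_commute: "cinner x y = cnj (cinner y x)"
    and cinner_add_left: "cinner (x + y) z = cinner x z + cinner y z"
    and cinner_scaleC_left: "cinner (c *\<^sub>C x) y = c * cinner x y"
    and inner_eq_Re_cinner: "inner x y = Re (cinner x y)"

class complex_hilbert = complex_inner + banach

text \<open>For metric spaces, second countability is separability.\<close>

class separable_complex_hilbert = complex_hilbert + second_countable_topology

instantiation complex :: separable_complex_hilbert
begin

definition scaleC_complex :: "complex \<Rightarrow> complex \<Rightarrow> complex"
  where "scaleC_complex c x = c * x"

definition cinner_complex :: "complex \<Rightarrow> complex \<Rightarrow> complex"
  where "cinner_complex x y = x * cnj y"

instance
  by standard
    (auto simp: scaleC_complex_def cinner_complex_def algebra_simps inner_complex_def
      scaleR_conv_of_real)

end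

lemma scaleC_one [simp]: "1 *\<^sub>C x = (x :: 'a :: complex_inner)"
  using scaleR_scaleC[of 1 x] by simp

lemma cinner_self: "cinner x x = complex_of_real ((norm x)\<^sup>2)"
  for x :: "'a :: complex_inner"
proof -
  have "Im (cinner x x) = 0"
    using arg_cong[OF cinner_commute[of x x], of Im] by simp
  then show ?thesis
    by (simp add: complex_eq_iff power2_norm_eq_inner inner_eq_Re_cinner)
qed

lemma cinner_add_right: "cinner x (y + z) = cinner x y + cinner x z"
  for x :: "'a :: complex_inner"
  by (metis cinner_add_left cinner_commute complex_cnj_add)

lemma cinner_scaleC_right: "cinner x (c *\<^sub>C y) = cnj c * cinner x y"
  for x :: "'a :: complex_inner"
  by (metis cinner_commute cinner_scaleC_left complex_cnj_mult)

lemma norm_scaleC: "norm (c *\<^sub>C x) = cmod c * norm x"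
  for x :: "'a :: complex_inner"
proof -
  have "cinner (c *\<^sub>C x) (c *\<^sub>C x) = c * cnj c * cinner x x"
    by (simp add: cinner_scaleC_left cinner_scaleC_right)
  also have "\<dots> = complex_of_real ((cmod c * norm x)\<^sup>2)"
    using complex_norm_square[of c] by (simp add: cinner_self power_mult_distrib)
  finally have "complex_of_real ((norm (c *\<^sub>C x))\<^sup>2) = complex_of_real ((cmod c * norm x)\<^sup>2)"
    by (simp only: cinner_self)
  then have "(norm (c *\<^sub>C x))\<^sup>2 = (cmod c * norm x)\<^sup>2"
    using of_real_eq_iff by blast
  then show ?thesis
    by (simp add: power2_eq_iff_nonneg)
qed

lemma cmod_cinner_le: "cmod (cinner x y) \<le> norm x * norm y"
  for x :: "'a :: complex_inner"
proof -
  obtain c where c: "cmod c = 1" "c * cinner x y = complex_of_real (cmod (cinner x y))"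
  proof (cases "cinner x y = 0")
    case True
    then show ?thesis using that[of 1] by simp
  next
    case False
    let ?c = "cnj (cinner x y) / complex_of_real (cmod (cinner x y))"
    show ?thesis
    proof (rule that[of ?c])
      show "cmod ?c = 1"
        using False by (simp add: norm_divide)
      show "?c * cinner x y = complex_of_real (cmod (cinner x y))"
        using False by (simp add: field_simps complex_norm_square[symmetric] power2_eq_square)
    qed
  qed
  have "cmod (cinner x y) = inner (c *\<^sub>C x) y"
    by (simp add: inner_eq_Re_cinner cinner_scaleC_left c)
  also have "\<dots> \<le> norm (c *\<^sub>C x) * norm y"
    by (rule norm_cauchy_schwarz)
  finally show ?thesis
    by (simp add: norm_scaleC c)
qed

lemma bounded_bilinear_scaleC:
  "bounded_bilinear (scaleC :: complex \<Rightarrow> 'a \<Rightarrow> 'a :: complex_inner)"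
proof
  show "\<exists>K. \<forall>c (x :: 'a). norm (c *\<^sub>C x) \<le> cmod c * norm x * K"
    by (rule exI[of _ 1]) (simp add: norm_scaleC)
  show "(r *\<^sub>R c) *\<^sub>C x = r *\<^sub>R c *\<^sub>C x" for r c and x :: 'a
    unfolding scaleR_scaleC[of r "c *\<^sub>C x"] by (simp add: scaleC_scaleC scaleR_conv_of_real)
  show "c *\<^sub>C r *\<^sub>R x = r *\<^sub>R c *\<^sub>C x" for r c and x :: 'a
    by (simp add: scaleR_scaleC scaleC_scaleC mult.commute)
qed (simp_all add: scaleC_add_left scaleC_add_right)

lemma bounded_bilinear_cinner:
  "bounded_bilinear (cinner :: 'a \<Rightarrow> 'a :: complex_inner \<Rightarrow> complex)"
proof
  show "\<exists>K. \<forall>x y :: 'a. cmod (cinner x y) \<le> norm x * norm y * K"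
    by (rule exI[of _ 1]) (simp add: cmod_cinner_le)
qed (simp_all add: cinner_add_left cinner_add_right scaleR_scaleC cinner_scaleC_left
    cinner_scaleC_right scaleC_complex_def)

section \<open>Operators\<close>

definition bounded_clinear :: "('a :: complex_inner \<Rightarrow> 'b :: complex_inner) \<Rightarrow> bool"
  where "bounded_clinear T \<longleftrightarrow> bounded_linear T \<and> (\<forall>c x. T (c *\<^sub>C x) = c *\<^sub>C T x)"

text \<open>The adjoint is unique if it exists; every bounded operator on a Hilbert space has one.\<close>

definition cadjoint :: "('a :: complex_inner \<Rightarrow> 'b :: complex_inner) \<Rightarrow> 'b \<Rightarrow> 'a"
    ("_\<^sup>\<dagger>" [1000] 999)
  where "T\<^sup>\<dagger> = (THE S. \<forall>x y. cinner (T x) y = cinner x (S y))"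

lemma cadjoint_eqI:
  assumes "\<And>x y. cinner (T x) y = cinner x (S y)"
  shows "T\<^sup>\<dagger> = S"
  unfolding cadjoint_def
proof (rule the_equality)
  show "\<forall>x y. cinner (T x) y = cinner x (S y)"
    using assms by blast
next
  fix R assume R: "\<forall>x y. cinner (T x) y = cinner x (R y)"
  show "R = S"
  proof
    fix y
    have "inner z (R y) = inner z (S y)" for z
      using R assms by (metis inner_eq_Re_cinner)
    then show "R y = S y"
      by (metis inner_commute vector_eq_rdot)
  qed
qed

definition unitary :: "('a :: complex_inner \<Rightarrow> 'a) \<Rightarrow> bool"
  where "unitary U \<longleftrightarrow> bounded_clinear U \<and> surj U \<and> (\<forall>x y. cinner (U x) (U y) = cinner x y)"

definition orthogonal_projection :: "('a :: complex_inner \<Rightarrow> 'a) \<Rightarrow> bool"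
  where "orthogonal_projection P \<longleftrightarrow> bounded_clinear P \<and> (\<forall>x. P (P x) = P x) \<and>
    (\<forall>x y. cinner (P x) y = cinner x (P y))"

text \<open>The set \<open>\<real>\<^sub>\<ge>\<^sub>0\<close> consists of complex numbers here, so the inner product is required to be real.\<close>

definition positive_operator :: "('a :: complex_inner \<Rightarrow> 'a) \<Rightarrow> bool"
  where "positive_operator T \<longleftrightarrow> bounded_clinear T \<and> (\<forall>x. cinner (T x) x \<in> \<real>\<^sub>\<ge>\<^sub>0)"

section \<open>The vector-valued Hardy space on the circle\<close>

text \<open>
  Normalised arc length, as a Borel probability measure on the plane that is carried by the unit
  circle.  Values of functions off the circle are therefore irrelevant up to almost everywhere
  equality.
\<close>

definition circle :: "complex measure"
  where "circle = distr (uniform_measure lborel {0..2 * pi}) borel cis"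

definition fourier_coeff :: "(complex \<Rightarrow> 'a :: separable_complex_hilbert) \<Rightarrow> int \<Rightarrow> 'a"
  where "fourier_coeff f n = (LINT z|circle. (z powi (- n)) *\<^sub>C f z)"

definition hardy_function :: "(complex \<Rightarrow> 'a :: separable_complex_hilbert) \<Rightarrow> bool"
  where "hardy_function f \<longleftrightarrow> f \<in> borel_measurable circle \<and>
    integrable circle (\<lambda>z. (norm (f z))\<^sup>2) \<and> (\<forall>n<0. fourier_coeff f n = 0)"

definition hardy_rel ::
    "(complex \<Rightarrow> 'a :: separable_complex_hilbert) \<Rightarrow> (complex \<Rightarrow> 'a) \<Rightarrow> bool"
  where "hardy_rel f g \<longleftrightarrow> hardy_function f \<and> hardy_function g \<and> (AE z in circle. f z = g z)"

lemma sets_circle [simp, measurable_cong]: "sets circle = sets borel"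
  and space_circle [simp]: "space circle = UNIV"
  by (simp_all add: circle_def)

lemma cis_measurable_uniform: "cis \<in> measurable (uniform_measure lborel {0..2 * pi}) borel"
proof -
  have "cis \<in> borel_measurable lborel"
    using borel_measurable_continuous_onI[OF continuous_on_cis[OF continuous_on_id]] by simp
  then show ?thesis
    by simp
qed

lemma prob_space_circle: "prob_space circle"
  unfolding circle_def
proof (rule prob_space.prob_space_distr[OF prob_space_uniform_measure cis_measurable_uniform])
qed auto

interpretation circle: prob_space circle
  by (rule prob_space_circle)

lemma AE_circle: "AE z in circle. cmod z = 1"
  unfolding circle_def by (subst AE_distr_iff[OF cis_measurable_uniform]) auto


lemma circle_integrable_if_square:
  fixes f :: "complex \<Rightarrow> 'a :: separable_complex_hilbert"
  assumes "f \<in> borel_measurable circle" "integrable circle (\<lambda>z. (norm (f z))\<^sup>2)"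
  shows "integrable circle f"
proof (rule Bochner_Integration.integrable_bound[of _ "\<lambda>z. 1 + (norm (f z))\<^sup>2"])
  have "norm (f z) \<le> 1 + (norm (f z))\<^sup>2" for z
    using sum_squares_bound[of 1 "norm (f z)"] norm_ge_zero[of "f z"]
    unfolding power_one mult_1_right by linarith
  then show "AE z in circle. norm (f z) \<le> norm (1 + (norm (f z))\<^sup>2)"
    by (simp add: abs_le_iff)
qed (use assms in auto)

lemma borel_measurable_scaleC [measurable]:
  fixes f :: "'b \<Rightarrow> 'a :: separable_complex_hilbert"
  assumes "f \<in> borel_measurable M" "h \<in> borel_measurable M"
  shows "(\<lambda>z. h z *\<^sub>C f z) \<in> borel_measurable M"
  by (rule borel_measurable_continuous_Pair[OF assms(2,1)])
    (intro bounded_bilinear.continuous_on[OF bounded_bilinear_scaleC] continuous_intros)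

lemma borel_measurable_cinner [measurable]:
  fixes f :: "'b \<Rightarrow> 'a :: separable_complex_hilbert"
  assumes "f \<in> borel_measurable M" "g \<in> borel_measurable M"
  shows "(\<lambda>z. cinner (f z) (g z)) \<in> borel_measurable M"
  by (rule borel_measurable_continuous_Pair[OF assms])
    (intro bounded_bilinear.continuous_on[OF bounded_bilinear_cinner] continuous_intros)

lemma measurable_powi [measurable]: "(\<lambda>z :: complex. z powi n) \<in> borel_measurable borel"
  by (cases n) (auto simp: power_int_def)

lemma circle_integrable_powi_scaleC:
  fixes f :: "complex \<Rightarrow> 'a :: separable_complex_hilbert"
  assumes "integrable circle f"
  shows "integrable circle (\<lambda>z. (z powi n) *\<^sub>C f z)"
proof (rule Bochner_Integration.integrable_bound[OF assms])
  show "AE z in circle. norm ((z powi n) *\<^sub>C f z) \<le> norm (f z)"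
    using AE_circle by eventually_elim (simp add: norm_scaleC norm_power_int)
qed (use assms in measurable)

lemma hardy_functionD:
  fixes f :: "complex \<Rightarrow> 'a :: separable_complex_hilbert"
  assumes "hardy_function f"
  shows "f \<in> borel_measurable circle" "integrable circle (\<lambda>z. (norm (f z))\<^sup>2)"
    and "integrable circle f" "integrable circle (\<lambda>z. (z powi n) *\<^sub>C f z)"
    and "m < 0 \<Longrightarrow> fourier_coeff f m = 0"
  using assms circle_integrable_if_square circle_integrable_powi_scaleC
  unfolding hardy_function_def by blast+

lemma hardy_function_zero: "hardy_function (\<lambda>_. 0)"
proof -
  have "c *\<^sub>C (0 :: 'a) = 0" for c
    by (metis mult_zero_right norm_eq_zero norm_scaleC norm_zero)
  then show ?thesis
    by (simp add: hardy_function_def fourier_coeff_def)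
qed

lemma hardy_function_bounded_clinear:
  fixes f :: "complex \<Rightarrow> 'a :: separable_complex_hilbert" and X :: "'a \<Rightarrow> 'b :: separable_complex_hilbert"
  assumes X: "bounded_clinear X" and f: "hardy_function f"
  shows "hardy_function (\<lambda>z. X (f z))"
proof -
  note f' = hardy_functionD[OF f]
  have lin: "bounded_linear X" and hom: "\<And>c x. X (c *\<^sub>C x) = c *\<^sub>C X x"
    using X by (auto simp: bounded_clinear_def)
  have meas: "(\<lambda>z. X (f z)) \<in> borel_measurable circle"
    using measurable_compose[OF f'(1) borel_measurable_continuous_onI[of X]]
      linear_continuous_on[OF lin] by blast
  obtain K where K: "\<And>x. norm (X x) \<le> norm x * K"
    using bounded_linear.bounded[OF lin] by blast
  have "integrable circle (\<lambda>z. (norm (X (f z)))\<^sup>2)"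
  proof (rule Bochner_Integration.integrable_bound[of _ "\<lambda>z. K\<^sup>2 * (norm (f z))\<^sup>2"])
    show "AE z in circle. norm ((norm (X (f z)))\<^sup>2) \<le> norm (K\<^sup>2 * (norm (f z))\<^sup>2)"
      using power_mono[OF K norm_ge_zero, of _ 2]
      by (simp add: power_mult_distrib mult.commute)
  qed (use meas f'(2) in auto)
  moreover have "fourier_coeff (\<lambda>z. X (f z)) n = X (fourier_coeff f n)" for n
    unfolding fourier_coeff_def hom[symmetric]
    by (rule integral_bounded_linear[OF lin f'(4)])
  ultimately show ?thesis
    using meas f'(5) linear_0[OF bounded_linear.linear[OF lin]]
    by (auto simp: hardy_function_def)
qed

lemma bounded_clinear_scaleC: "bounded_clinear (\<lambda>x :: 'a :: complex_inner. c *\<^sub>C x)"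
  by (simp add: bounded_clinear_def bounded_bilinear.bounded_linear_right[OF bounded_bilinear_scaleC]
      scaleC_scaleC mult.commute)

lemma bounded_clinear_scaleC_left: "bounded_clinear (\<lambda>c. c *\<^sub>C (x :: 'a :: complex_inner))"
  by (simp add: bounded_clinear_def bounded_bilinear.bounded_linear_left[OF bounded_bilinear_scaleC]
      scaleC_scaleC scaleC_complex_def)

lemma hardy_function_add:
  fixes f g :: "complex \<Rightarrow> 'a :: separable_complex_hilbert"
  assumes f: "hardy_function f" and g: "hardy_function g"
  shows "hardy_function (\<lambda>z. f z + g z)"
proof -
  note f' = hardy_functionD[OF f] and g' = hardy_functionD[OF g]
  have "integrable circle (\<lambda>z. (norm (f z + g z))\<^sup>2)"
  proof (rule Bochner_Integration.integrable_bound[of _ "\<lambda>z. 2 * (norm (f z))\<^sup>2 + 2 * (norm (g z))\<^sup>2"])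
    have "(norm (f z + g z))\<^sup>2 \<le> 2 * (norm (f z))\<^sup>2 + 2 * (norm (g z))\<^sup>2" for z
    proof -
      have "(norm (f z + g z))\<^sup>2 \<le> (norm (f z) + norm (g z))\<^sup>2"
        by (intro power_mono norm_triangle_ineq) simp
      then show ?thesis
        using sum_squares_bound[of "norm (f z)" "norm (g z)"] by (simp add: power2_sum)
    qed
    then show "AE z in circle. norm ((norm (f z + g z))\<^sup>2) \<le>
        norm (2 * (norm (f z))\<^sup>2 + 2 * (norm (g z))\<^sup>2)"
      by simp
  qed (use f' g' in auto)
  moreover have "fourier_coeff (\<lambda>z. f z + g z) n = fourier_coeff f n + fourier_coeff g n" for n
    using f'(4) g'(4) by (simp add: fourier_coeff_def scaleC_add_right)
  ultimately show ?thesis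
    using f' g' by (auto simp: hardy_function_def)
qed

lemma hardy_function_shift:
  fixes f :: "complex \<Rightarrow> 'a :: separable_complex_hilbert"
  assumes f: "hardy_function f"
  shows "hardy_function (\<lambda>z. z *\<^sub>C f z)"
proof -
  note f' = hardy_functionD[OF f]
  have [measurable]: "f \<in> borel_measurable borel"
    using f'(1) by (simp cong: measurable_cong_sets)
  have meas: "(\<lambda>z. z *\<^sub>C f z) \<in> borel_measurable circle"
    by measurable
  have "integrable circle (\<lambda>z. (norm (z *\<^sub>C f z))\<^sup>2)"
  proof (rule Bochner_Integration.integrable_bound[OF f'(2)])
    show "AE z in circle. norm ((norm (z *\<^sub>C f z))\<^sup>2) \<le> norm ((norm (f z))\<^sup>2)"
      using AE_circle by eventually_elim (simp add: norm_scaleC)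
  qed (use meas in measurable)
  moreover have "fourier_coeff (\<lambda>z. z *\<^sub>C f z) n = fourier_coeff f (n - 1)" for n
    unfolding fourier_coeff_def
  proof (rule integral_cong_AE)
    show "AE z in circle. (z powi (- n)) *\<^sub>C z *\<^sub>C f z = (z powi (- (n - 1))) *\<^sub>C f z"
      using AE_circle
    proof eventually_elim
      case (elim z)
      then have "z \<noteq> 0" by auto
      then have "z powi (- n) * z = z powi (- (n - 1))"
        using power_int_add_1[of z "- n"] by simp
      then show ?case by (simp add: scaleC_scaleC)
    qed
  qed measurable
  ultimately show ?thesis
    using meas f'(5) by (auto simp: hardy_function_def)
qed

quotient_type (overloaded) 'a hardy = "complex \<Rightarrow> 'a :: separable_complex_hilbert" / partial: hardy_rel
proof (rule part_equivpI)
  show "\<exists>f :: complex \<Rightarrow> 'a. hardy_rel f f"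
    by (intro exI[of _ "\<lambda>_. 0"]) (simp add: hardy_rel_def hardy_function_zero)
  show "symp (hardy_rel :: (complex \<Rightarrow> 'a) \<Rightarrow> _)"
    by (auto simp: hardy_rel_def symp_def)
  show "transp (hardy_rel :: (complex \<Rightarrow> 'a) \<Rightarrow> _)"
    by (auto simp: hardy_rel_def transp_def)
qed

lemma integrable_cinner_hardy:
  fixes f g :: "complex \<Rightarrow> 'a :: separable_complex_hilbert"
  assumes f: "hardy_function f" and g: "hardy_function g"
  shows "integrable circle (\<lambda>z. cinner (f z) (g z))"
proof (rule Bochner_Integration.integrable_bound[of _ "\<lambda>z. (norm (f z))\<^sup>2 + (norm (g z))\<^sup>2"])
  have "cmod (cinner (f z) (g z)) \<le> (norm (f z))\<^sup>2 + (norm (g z))\<^sup>2" for z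
  proof -
    have "norm (f z) * norm (g z) \<ge> 0" by simp
    then show ?thesis
      using cmod_cinner_le[of "f z" "g z"] sum_squares_bound[of "norm (f z)" "norm (g z)"] by linarith
  qed
  then show "AE z in circle. norm (cinner (f z) (g z)) \<le> norm ((norm (f z))\<^sup>2 + (norm (g z))\<^sup>2)"
    by simp
qed (use hardy_functionD[OF f] hardy_functionD[OF g] in auto)

lemma hardy_rel_zero: "hardy_rel (\<lambda>_. 0) (\<lambda>_. 0)"
  by (simp add: hardy_rel_def hardy_function_zero)

lemma hardy_rel_add:
  assumes "hardy_rel f f'" "hardy_rel g g'"
  shows "hardy_rel (\<lambda>z. f z + g z) (\<lambda>z. f' z + g' z)"
proof -
  have "AE z in circle. f z = f' z" "AE z in circle. g z = g' z"
    using assms by (auto simp: hardy_rel_def)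
  then have "AE z in circle. f z + g z = f' z + g' z"
    by eventually_elim simp
  then show ?thesis
    using assms by (simp add: hardy_rel_def hardy_function_add)
qed

lemma hardy_rel_bounded_clinear:
  assumes "bounded_clinear X" "hardy_rel f g"
  shows "hardy_rel (\<lambda>z. X (f z)) (\<lambda>z. X (g z))"
proof -
  have "AE z in circle. f z = g z"
    using assms by (auto simp: hardy_rel_def)
  then have "AE z in circle. X (f z) = X (g z)"
    by eventually_elim simp
  then show ?thesis
    using assms hardy_function_bounded_clinear[OF assms(1)] by (simp add: hardy_rel_def)
qed

lemma hardy_rel_shift:
  assumes "hardy_rel f g"
  shows "hardy_rel (\<lambda>z. z *\<^sub>C f z) (\<lambda>z. z *\<^sub>C g z)"
proof -
  have "AE z in circle. f z = g z"
    using assms by (auto simp: hardy_rel_def)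
  then have "AE z in circle. z *\<^sub>C f z = z *\<^sub>C g z"
    by eventually_elim simp
  then show ?thesis
    using assms by (simp add: hardy_rel_def hardy_function_shift)
qed

instantiation hardy :: (separable_complex_hilbert) complex_inner
begin

lift_definition zero_hardy :: "'a hardy" is "\<lambda>_. 0"
  by (rule hardy_rel_zero)

lift_definition plus_hardy :: "'a hardy \<Rightarrow> 'a hardy \<Rightarrow> 'a hardy" is "\<lambda>f g z. f z + g z"
  by (rule hardy_rel_add)

lift_definition scaleC_hardy :: "complex \<Rightarrow> 'a hardy \<Rightarrow> 'a hardy" is "\<lambda>c f z. c *\<^sub>C f z"
  by (simp add: hardy_rel_bounded_clinear[OF bounded_clinear_scaleC])

lift_definition cinner_hardy :: "'a hardy \<Rightarrow> 'a hardy \<Rightarrow> complex"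
  is "\<lambda>f g. LINT z|circle. cinner (f z) (g z)"
proof -
  fix f f' g g' :: "complex \<Rightarrow> 'a"
  assume "hardy_rel f f'" "hardy_rel g g'"
  then have *: "hardy_function f" "hardy_function f'" "hardy_function g" "hardy_function g'"
    and ae: "AE z in circle. f z = f' z" "AE z in circle. g z = g' z"
    by (auto simp: hardy_rel_def)
  show "(LINT z|circle. cinner (f z) (g z)) = (LINT z|circle. cinner (f' z) (g' z))"
  proof (rule integral_cong_AE)
    show "AE z in circle. cinner (f z) (g z) = cinner (f' z) (g' z)"
      using ae by eventually_elim simp
  qed (use * integrable_cinner_hardy borel_measurable_integrable in blast)+
qed

definition scaleR_hardy :: "real \<Rightarrow> 'a hardy \<Rightarrow> 'a hardy"
  where "scaleR_hardy r f = complex_of_real r *\<^sub>C f"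

definition uminus_hardy :: "'a hardy \<Rightarrow> 'a hardy"
  where "uminus_hardy f = (- 1) *\<^sub>C f"

definition minus_hardy :: "'a hardy \<Rightarrow> 'a hardy \<Rightarrow> 'a hardy"
  where "minus_hardy f g = f + - g"

definition inner_hardy :: "'a hardy \<Rightarrow> 'a hardy \<Rightarrow> real"
  where "inner_hardy f g = Re (cinner f g)"

definition norm_hardy :: "'a hardy \<Rightarrow> real"
  where "norm_hardy f = sqrt (inner f f)"

definition sgn_hardy :: "'a hardy \<Rightarrow> 'a hardy"
  where "sgn_hardy f = inverse (norm f) *\<^sub>R f"

definition dist_hardy :: "'a hardy \<Rightarrow> 'a hardy \<Rightarrow> real"
  where "dist_hardy f g = norm (f - g)"

definition uniformity_hardy :: "('a hardy \<times> 'a hardy) filter"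
  where "uniformity_hardy = (INF e\<in>{0<..}. principal {(f, g). dist f g < e})"

definition open_hardy :: "'a hardy set \<Rightarrow> bool"
  where "open_hardy S \<longleftrightarrow> (\<forall>f\<in>S. \<forall>\<^sub>F (f', g) in uniformity. f' = f \<longrightarrow> g \<in> S)"

instance
proof
  fix f g h :: "'a hardy" and c d :: complex and r s :: real
  show assoc: "f + g + h = f + (g + h)"
    by transfer (simp add: hardy_rel_def add.assoc hardy_function_add)
  show comm: "f + g = g + f"
    by transfer (simp add: hardy_rel_def add.commute hardy_function_add)
  show zero: "0 + f = f"
    by transfer (simp add: hardy_rel_def)
  note scaleC_hardy_function = hardy_function_bounded_clinear[OF bounded_clinear_scaleC]
  show addr: "c *\<^sub>C (f + g) = c *\<^sub>C f + c *\<^sub>C g" for c and f g :: "'a hardy"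
    by transfer (simp add: hardy_rel_def scaleC_add_right hardy_function_add scaleC_hardy_function)
  show addl: "(c + d) *\<^sub>C f = c *\<^sub>C f + d *\<^sub>C f" for c d and f :: "'a hardy"
    by transfer (simp add: hardy_rel_def scaleC_add_left hardy_function_add scaleC_hardy_function)
  show assocC: "c *\<^sub>C d *\<^sub>C f = (c * d) *\<^sub>C f" for c d and f :: "'a hardy"
    by transfer (simp add: hardy_rel_def scaleC_scaleC scaleC_hardy_function)
  have one: "1 *\<^sub>C f = f" for f :: "'a hardy"
    by transfer (auto simp: hardy_rel_def)
  have zeroC: "0 *\<^sub>C f = 0" for f :: "'a hardy"
  proof transfer
    fix f :: "complex \<Rightarrow> 'a" assume "hardy_rel f f"
    moreover have "0 *\<^sub>C x = 0" for x :: 'a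
      by (metis mult_zero_left norm_eq_zero norm_scaleC norm_zero)
    ultimately show "hardy_rel (\<lambda>z. 0 *\<^sub>C f z) (\<lambda>_. 0)"
      by (auto simp: hardy_rel_def hardy_function_zero)
  qed
  show "- f + f = 0"
    using addl[of "-1" 1 f] by (simp add: uminus_hardy_def one zeroC)
  show "f - g = f + - g"
    by (rule minus_hardy_def)
  show "r *\<^sub>R (f + g) = r *\<^sub>R f + r *\<^sub>R g" "(r + s) *\<^sub>R f = r *\<^sub>R f + s *\<^sub>R f"
    "r *\<^sub>R s *\<^sub>R f = (r * s) *\<^sub>R f" "1 *\<^sub>R f = f"
    by (simp_all add: scaleR_hardy_def addr addl assocC one)
  show "r *\<^sub>R f = complex_of_real r *\<^sub>C f"
    by (rule scaleR_hardy_def)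
  show cadd: "cinner (f + g) h = cinner f h + cinner g h"
  proof transfer
    fix f g h :: "complex \<Rightarrow> 'a" assume "hardy_rel f f" "hardy_rel g g" "hardy_rel h h"
    then have "integrable circle (\<lambda>z. cinner (f z) (h z))" "integrable circle (\<lambda>z. cinner (g z) (h z))"
      by (auto simp: hardy_rel_def intro: integrable_cinner_hardy)
    then show "(LINT z|circle. cinner (f z + g z) (h z)) =
        (LINT z|circle. cinner (f z) (h z)) + (LINT z|circle. cinner (g z) (h z))"
      by (simp add: cinner_add_left)
  qed
  show cscale: "cinner (c *\<^sub>C f) g = c * cinner f g" for c
    by transfer (simp add: cinner_scaleC_left)
  show comm': "cinner f g = cnj (cinner g f)"
  proof transfer
    fix f g :: "complex \<Rightarrow> 'a"
    have "(LINT z|circle. cinner (f z) (g z)) = (LINT z|circle. cnj (cinner (g z) (f z)))"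
      by (rule Bochner_Integration.integral_cong[OF refl cinner_commute])
    then show "(LINT z|circle. cinner (f z) (g z)) = cnj (LINT z|circle. cinner (g z) (f z))"
      by simp
  qed
  show "inner f g = Re (cinner f g)"
    by (rule inner_hardy_def)
  show "inner f g = inner g f"
    unfolding inner_hardy_def by (subst comm') simp
  show "inner (f + g) h = inner f h + inner g h"
    by (simp add: inner_hardy_def cadd)
  show "inner (r *\<^sub>R f) g = r * inner f g"
    by (simp add: inner_hardy_def scaleR_hardy_def cscale)
  have self: "hardy_rel f f \<Longrightarrow>
      (LINT z|circle. cinner (f z) (f z)) = complex_of_real (LINT z|circle. (norm (f z))\<^sup>2)"
    for f :: "complex \<Rightarrow> 'a"
    by (simp only: cinner_self integral_complex_of_real)
  show "0 \<le> inner f f"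
    unfolding inner_hardy_def by transfer (simp add: self)
  show "inner f f = 0 \<longleftrightarrow> f = 0"
    unfolding inner_hardy_def
  proof transfer
    fix f :: "complex \<Rightarrow> 'a" assume f: "hardy_rel f f"
    then have "integrable circle (\<lambda>z. (norm (f z))\<^sup>2)"
      by (auto simp: hardy_rel_def hardy_function_def)
    then show "Re (LINT z|circle. cinner (f z) (f z)) = 0 \<longleftrightarrow> hardy_rel f (\<lambda>_. 0)"
      using f by (simp add: self integral_nonneg_eq_0_iff_AE) (simp add: hardy_rel_def hardy_function_zero)
  qed
  show "norm f = sqrt (inner f f)"
    by (rule norm_hardy_def)
  show "sgn f = inverse (norm f) *\<^sub>R f"
    by (rule sgn_hardy_def)
  show "dist f g = norm (f - g)"
    by (rule dist_hardy_def)
  show "(uniformity :: ('a hardy \<times> 'a hardy) filter) =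
      (INF e\<in>{0<..}. principal {(f, g). dist f g < e})"
    by (rule uniformity_hardy_def)
  show "open S \<longleftrightarrow> (\<forall>f\<in>S. \<forall>\<^sub>F (f', g) in uniformity. f' = f \<longrightarrow> g \<in> S)" for S :: "'a hardy set"
    by (rule open_hardy_def)
qed

end

section \<open>The identification with the Hilbert space tensor product\<close>

text \<open>
  The scalar Hardy space is \<open>complex hardy\<close>, and \<open>f \<otimes> s\<close> is the function whose value at \<open>z\<close> is
  \<open>f z *\<^sub>C s\<close>.  Under this identification \<open>I \<otimes> X\<close> is the pointwise application of \<open>X\<close>, and
  \<open>S\<^sub>z \<otimes> X\<close> is its composition with multiplication by \<open>z\<close>.
\<close>

lift_definition hardy_tensor ::
    "complex hardy \<Rightarrow> 'a \<Rightarrow> 'a :: separable_complex_hilbert hardy" (infixr "\<otimes>" 70)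
  is "\<lambda>f s z. f z *\<^sub>C s"
  by (simp add: hardy_rel_bounded_clinear[OF bounded_clinear_scaleC_left])

lift_definition shift :: "'a :: separable_complex_hilbert hardy \<Rightarrow> 'a hardy" is "\<lambda>f z. z *\<^sub>C f z"
  by (rule hardy_rel_shift)

text \<open>
  Functions \<open>X\<close> that are not bounded and complex linear need not preserve the Hardy space; the
  value 0 is assigned to them only to make \<open>I_tensor\<close> total.
\<close>

lift_definition I_tensor :: "('a \<Rightarrow> 'a) \<Rightarrow> 'a :: separable_complex_hilbert hardy \<Rightarrow> 'a hardy"
  is "\<lambda>X f. if bounded_clinear X then (\<lambda>z. X (f z)) else (\<lambda>_. 0)"
  by (simp add: hardy_rel_bounded_clinear hardy_rel_zero)

definition Sz_tensor :: "('a \<Rightarrow> 'a) \<Rightarrow> 'a :: separable_complex_hilbert hardy \<Rightarrow> 'a hardy"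
  where "Sz_tensor X f = shift (I_tensor X f)"

lemma I_tensor_hardy_tensor:
  assumes "bounded_clinear X"
  shows "I_tensor X (f \<otimes> s) = f \<otimes> X s"
  using assms
proof transfer
  fix X :: "'a \<Rightarrow> 'a" and f :: "complex \<Rightarrow> complex" and s :: 'a
  assume X: "bounded_clinear X" and f: "hardy_rel f f"
  have "hardy_function (\<lambda>z. f z *\<^sub>C X s)"
    using f hardy_function_bounded_clinear[OF bounded_clinear_scaleC_left]
    by (auto simp: hardy_rel_def)
  then show "hardy_rel (if bounded_clinear X then \<lambda>z. X (f z *\<^sub>C s) else (\<lambda>_. 0)) (\<lambda>z. f z *\<^sub>C X s)"
    using X by (simp add: hardy_rel_def bounded_clinear_def)
qed

lemma shift_hardy_tensor: "shift (f \<otimes> s) = shift f \<otimes> s"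
proof transfer
  fix f :: "complex \<Rightarrow> complex" and s :: 'a
  assume f: "hardy_rel f f"
  then have "hardy_function (\<lambda>z. (z *\<^sub>C f z) *\<^sub>C s)"
    using hardy_function_bounded_clinear[OF bounded_clinear_scaleC_left hardy_function_shift]
    by (auto simp: hardy_rel_def)
  then show "hardy_rel (\<lambda>z. z *\<^sub>C f z *\<^sub>C s) (\<lambda>z. (z *\<^sub>C f z) *\<^sub>C s)"
    by (simp add: hardy_rel_def scaleC_scaleC scaleC_complex_def)
qed

lemma Sz_tensor_hardy_tensor:
  assumes "bounded_clinear X"
  shows "Sz_tensor X (f \<otimes> s) = shift f \<otimes> X s"
  by (simp add: Sz_tensor_def I_tensor_hardy_tensor[OF assms] shift_hardy_tensor)

section \<open>BCL pairs\<close>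

definition BCL_triple :: "('a :: separable_complex_hilbert \<Rightarrow> 'a) \<Rightarrow> ('a \<Rightarrow> 'a) \<Rightarrow> bool"
  where "BCL_triple U P \<longleftrightarrow> unitary U \<and> orthogonal_projection P"

definition perp :: "('a :: complex_inner \<Rightarrow> 'a) \<Rightarrow> 'a \<Rightarrow> 'a" ("_\<^sup>\<perp>" [1000] 999)
  where "P\<^sup>\<perp> = (\<lambda>s. s - P s)"

definition M_phi1 ::
    "('a \<Rightarrow> 'a) \<Rightarrow> ('a \<Rightarrow> 'a) \<Rightarrow> 'a :: separable_complex_hilbert hardy \<Rightarrow> 'a hardy"
  where "M_phi1 U P = (\<lambda>f. I_tensor (P \<circ> U\<^sup>\<dagger>) f + Sz_tensor (P\<^sup>\<perp> \<circ> U\<^sup>\<dagger>) f)"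

definition M_phi2 ::
    "('a \<Rightarrow> 'a) \<Rightarrow> ('a \<Rightarrow> 'a) \<Rightarrow> 'a :: separable_complex_hilbert hardy \<Rightarrow> 'a hardy"
  where "M_phi2 U P = (\<lambda>f. I_tensor (U \<circ> P\<^sup>\<perp>) f + Sz_tensor (U \<circ> P) f)"

definition H_op :: "('a :: complex_inner \<Rightarrow> 'a) \<Rightarrow> ('a \<Rightarrow> 'a) \<Rightarrow> 'a \<Rightarrow> 'a"
  where "H_op V1 V2 = (\<lambda>x. (V2 \<circ> V2\<^sup>\<dagger>) x - (V1 \<circ> V1\<^sup>\<dagger>) x
    - (V2 \<circ> V2 \<circ> V2\<^sup>\<dagger> \<circ> V2\<^sup>\<dagger>) x + (V1 \<circ> V2 \<circ> V1\<^sup>\<dagger> \<circ> V2\<^sup>\<dagger>) x)"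

end

theory Submission
  imports Defs
begin

text \<open>
  Write \<open>Q = U P U\<^sup>\<dagger>\<close>, and let \<open>f\<^sub>0\<close>, \<open>f\<^sub>1\<close> be the first two Fourier coefficients of \<open>f\<close>. Since
  \<open>V\<^sub>1 V\<^sub>2\<close> is the shift, \<open>H\<close> only sees these two coefficients:
  \<open>\<langle>H f, f\<rangle> = \<langle>Q c, c\<rangle> - \<langle>P f\<^sub>0, f\<^sub>0\<rangle>\<close> for \<open>c = P\<^sup>\<perp> U\<^sup>\<dagger> f\<^sub>0 + P U\<^sup>\<dagger> f\<^sub>1\<close>.
  Testing \<open>A \<ge> 0\<close> on the vectors \<open>U P v\<close> gives \<open>P U P = 0\<close>. Hence \<open>A \<ge> 0\<close> alone forces
  \<open>B = D = 0\<close>, and then \<open>\<langle>H f, f\<rangle> = \<langle>A f\<^sub>0, f\<^sub>0\<rangle>\<close>. Conversely \<open>H \<ge> 0\<close> yields \<open>A \<ge> 0\<close> by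
  testing on constant functions.
\<close>

section \<open>Bounded operators and adjoints\<close>

lemma cinner_diff_left: "cinner (x - y) z = cinner x z - cinner y z"
  for x :: "'a :: complex_inner"
  using cinner_add_left[of "x - y" y z] by simp

lemma cinner_diff_right: "cinner x (y - z) = cinner x y - cinner x z"
  for x :: "'a :: complex_inner"
  using cinner_add_right[of x "y - z" z] by simp

lemma cinner_zero_left [simp]: "cinner 0 y = 0"
  and cinner_zero_right [simp]: "cinner y 0 = 0"
  for y :: "'a :: complex_inner"
  using cinner_diff_left[of y y y] cinner_diff_right[of y y y] by simp_all

lemma cinner_right_eqI: "x = y"
  if "\<And>z. cinner z x = cinner z y" for x y :: "'a :: complex_inner"
  using that by (metis inner_eq_Re_cinner inner_commute vector_eq_rdot)

lemma cinner_left_eqI: "x = y"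
  if "\<And>z. cinner x z = cinner y z" for x y :: "'a :: complex_inner"
  using that by (metis cinner_right_eqI cinner_commute)

lemma scaleC_zero_right [simp]: "c *\<^sub>C 0 = (0 :: 'a :: complex_inner)"
  using scaleC_add_right[of c 0 0] by simp

lemma scaleC_diff_right: "c *\<^sub>C (x - y) = c *\<^sub>C x - c *\<^sub>C y"
  for x :: "'a :: complex_inner"
  using scaleC_add_right[of c "x - y" y] by simp

lemma bounded_clinear_add: "bounded_clinear T \<Longrightarrow> T (x + y) = T x + T y"
  and bounded_clinear_diff: "bounded_clinear T \<Longrightarrow> T (x - y) = T x - T y"
  and bounded_clinear_zero: "bounded_clinear T \<Longrightarrow> T 0 = 0"
  by (simp_all add: bounded_clinear_def bounded_linear.linear linear_add linear_diff linear_0)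

lemma bounded_clinear_ident: "bounded_clinear (\<lambda>x. x)"
  by (simp add: bounded_clinear_def)

lemma bounded_clinear_compose:
  "bounded_clinear T \<Longrightarrow> bounded_clinear R \<Longrightarrow> bounded_clinear (\<lambda>x. T (R x))"
  by (simp add: bounded_clinear_def bounded_linear_compose)

lemma bounded_clinear_sum:
  "bounded_clinear T \<Longrightarrow> bounded_clinear R \<Longrightarrow> bounded_clinear (\<lambda>x. T x + R x)"
  by (simp add: bounded_clinear_def bounded_linear_add scaleC_add_right)

lemma bounded_clinear_difference:
  "bounded_clinear T \<Longrightarrow> bounded_clinear R \<Longrightarrow> bounded_clinear (\<lambda>x. T x - R x)"
  by (simp add: bounded_clinear_def bounded_linear_sub scaleC_diff_right)

text \<open>Linearity follows by moving \<open>T'\<close> across the inner product. For boundedness,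
  the square of the norm of \<open>T' y\<close> is the inner product of \<open>T (T' y)\<close> with
  \<open>y\<close>, hence at most norm (T' y) * K * norm y, and one factor cancels.
  \<open>T'\<close> is an explicit function because \<open>hardy\<close> carries only the structure
  of an inner product space, so adjoints on it have to be exhibited.\<close>

lemma bounded_clinear_adjoint:
  fixes T :: "'a :: complex_inner \<Rightarrow> 'b :: complex_inner"
  assumes T: "bounded_clinear T" and adj: "\<And>x y. cinner (T x) y = cinner x (T' y)"
  shows "bounded_clinear T'"
proof -
  have add: "T' (x + y) = T' x + T' y" for x y
    by (rule cinner_right_eqI) (simp add: cinner_add_right flip: adj)
  have scale: "T' (c *\<^sub>C x) = c *\<^sub>C T' x" for c x
    by (rule cinner_right_eqI) (simp add: cinner_scaleC_right flip: adj)
  obtain K where "K \<ge> 0" and K: "\<And>x. norm (T x) \<le> norm x * K"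
    using T bounded_linear.nonneg_bounded unfolding bounded_clinear_def by blast
  have "norm (T' y) \<le> norm y * K" for y
  proof (cases "norm (T' y) = 0")
    case True
    then show ?thesis
      using \<open>K \<ge> 0\<close> by simp
  next
    case False
    have "(norm (T' y))\<^sup>2 = cmod (cinner (T' y) (T' y))"
      unfolding cinner_self norm_of_real by simp
    also have "\<dots> = cmod (cinner (T (T' y)) y)"
      by (simp add: adj)
    also have "\<dots> \<le> norm (T (T' y)) * norm y"
      by (rule cmod_cinner_le)
    also have "\<dots> \<le> norm (T' y) * K * norm y"
      by (intro mult_right_mono K) simp
    finally show ?thesis
      using False by (simp add: power2_eq_square mult_ac)
  qed
  then have "bounded_linear T'"
    by (intro bounded_linear_intro[where K = K]) (simp_all add: add scaleR_scaleC scale)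
  then show ?thesis
    by (simp add: bounded_clinear_def scale)
qed

section \<open>The backward shift and constant functions\<close>

text \<open>Pulled back along \<open>cis\<close>, the integrand becomes
  \<open>exp (\<i> n t)\<close> with constant density on [0, 2 pi]. For nonzero \<open>n\<close> its
  antiderivative \<open>?F\<close> exists and takes equal values at the two endpoints.\<close>

lemma integral_circle_powi: "(LINT z|circle. z powi n) = 0"
  if "n \<noteq> 0"
proof -
  let ?e = "\<lambda>t. exp (\<i> * of_int n * of_real t) :: complex"
  let ?F = "\<lambda>t. ?e t / (\<i> * of_int n)"
  let ?d = "\<lambda>t. indicator {0..2 * pi} t / (2 * pi) :: real"
  have uniform: "uniform_measure lborel {0..2 * pi} = density lborel (\<lambda>t. ennreal (?d t))"
    unfolding uniform_measure_def
    by (intro arg_cong[of _ _ "density lborel"] ext)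
      (auto simp: indicator_def divide_ennreal[symmetric])
  have e: "cis t powi n = ?e t" for t
    by (simp only: cis_power_int) (simp add: cis_conv_exp mult_ac)
  have "(LINT z|circle. z powi n) = (LINT t|lborel. ?d t *\<^sub>R (cis t powi n))"
  proof -
    have "(LINT z|circle. z powi n) = (LINT t|uniform_measure lborel {0..2 * pi}. cis t powi n)"
      unfolding circle_def by (rule integral_distr[OF cis_measurable_uniform measurable_powi])
    also have "\<dots> = (LINT t|density lborel (\<lambda>t. ennreal (?d t)). ?e t)"
      by (simp only: e uniform)
    also have "\<dots> = (LINT t|lborel. ?d t *\<^sub>R ?e t)"
      by (rule integral_density)
        (auto intro!: borel_measurable_continuous_onI continuous_intros)
    finally show ?thesis
      by (simp only: e)
  qed
  also have "\<dots> = (LINT t|lborel. (1 / (2 * pi)) *\<^sub>R (indicator {0..2 * pi} t *\<^sub>R ?e t))"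
    by (intro Bochner_Integration.integral_cong) (auto simp: e indicator_def)
  also have "\<dots> = (1 / (2 * pi)) *\<^sub>R (?F (2 * pi) - ?F 0)"
  proof (subst integral_scaleR_right, rule arg_cong[of _ _ "scaleR _"], rule integral_FTC_atLeastAtMost)
    show "(?F has_vector_derivative ?e t) (at t within {0..2 * pi})" for t
      using that by (auto intro!: derivative_eq_intros has_vector_derivative_real_field simp: field_simps)
  qed (auto intro!: continuous_intros)
  also have "?F (2 * pi) = ?F 0"
    using exp_integer_2pi[of "of_int n"] by (simp add: mult_ac)
  finally show ?thesis
    by simp
qed

text \<open>The vector comes out of the integral, and a nonzero power of z integrates to zero, so
  all negative coefficients vanish.\<close>

lemma hardy_function_const: "hardy_function (\<lambda>_. x)"
  for x :: "'a :: separable_complex_hilbert"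
proof -
  have "fourier_coeff (\<lambda>_. x) n = (LINT z|circle. z powi (- n)) *\<^sub>C x" for n
    unfolding fourier_coeff_def
  proof (rule integral_bounded_linear)
    show "bounded_linear (\<lambda>c. c *\<^sub>C x)"
      using bounded_clinear_scaleC_left[of x] by (simp add: bounded_clinear_def)
    show "integrable circle (\<lambda>z. z powi (- n))"
      using circle_integrable_powi_scaleC[of "\<lambda>_. 1 :: complex" "- n"]
      by (simp add: scaleC_complex_def)
  qed
  then show ?thesis
    by (simp add: hardy_function_def integral_circle_powi bounded_clinear_zero[OF bounded_clinear_scaleC_left])
qed

lemma fourier_coeff_powi_scaleC:
  "fourier_coeff (\<lambda>z. (z powi m) *\<^sub>C f z) n = fourier_coeff f (n - m)"
  if [measurable]: "f \<in> borel_measurable borel"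
  for f :: "complex \<Rightarrow> 'a :: separable_complex_hilbert"
  unfolding fourier_coeff_def
proof (rule integral_cong_AE)
  show "AE z in circle. (z powi (- n)) *\<^sub>C (z powi m) *\<^sub>C f z = (z powi (- (n - m))) *\<^sub>C f z"
    using AE_circle
  proof eventually_elim
    case (elim z)
    \<comment> \<open>Exponents can be added for arbitrary integers only away from the origin, where
      negative powers take a default value; the measure does not see the origin.\<close>
    then have "z \<noteq> 0" by auto
    then have "z powi (- n) * z powi m = z powi (- (n - m))"
      by (simp flip: power_int_add)
    then show ?case by (simp add: scaleC_scaleC)
  qed
qed measurable

lemma fourier_coeff_cong_AE: "fourier_coeff f n = fourier_coeff g n"
  if "hardy_rel f g"
proof -
  have "hardy_function f" "hardy_function g" and ae: "AE z in circle. f z = g z"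
    using that by (auto simp: hardy_rel_def)
  then have [measurable]: "f \<in> borel_measurable borel" "g \<in> borel_measurable borel"
    using hardy_functionD(1) by (auto cong: measurable_cong_sets)
  show ?thesis
    unfolding fourier_coeff_def
  proof (rule integral_cong_AE)
    show "AE z in circle. (z powi (- n)) *\<^sub>C f z = (z powi (- n)) *\<^sub>C g z"
      using ae by eventually_elim simp
  qed measurable
qed

lemma hardy_function_diff:
  "hardy_function f \<Longrightarrow> hardy_function g \<Longrightarrow> hardy_function (\<lambda>z. f z - g z)"
  for f :: "complex \<Rightarrow> 'a :: separable_complex_hilbert"
  using hardy_function_add[of f "\<lambda>z. (- 1) *\<^sub>C g z"]
    hardy_function_bounded_clinear[OF bounded_clinear_scaleC, of g "- 1"]
  by (simp flip: scaleR_scaleC[of "- 1", simplified])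

section \<open>Zeroth coefficient, constants and the adjoint of the shift\<close>

lift_definition coeff0 :: "'a :: separable_complex_hilbert hardy \<Rightarrow> 'a"
  is "\<lambda>f. fourier_coeff f 0"
  by (rule fourier_coeff_cong_AE)

lift_definition const_hardy :: "'a :: separable_complex_hilbert \<Rightarrow> 'a hardy"
  is "\<lambda>x _. x"
  by (simp add: hardy_rel_def hardy_function_const)

text \<open>Subtracting the zeroth coefficient makes all coefficients at \<open>n \<le> 0\<close>
  vanish, so lowering every frequency by one still leaves no negative frequency.\<close>

lemma hardy_function_backward_shift:
  "hardy_function (\<lambda>z. (z powi (- 1)) *\<^sub>C (f z - fourier_coeff f 0))"
  if f: "hardy_function f" for f :: "complex \<Rightarrow> 'a :: separable_complex_hilbert"
proof -
  define g where "g z = f z - fourier_coeff f 0" for z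
  have g: "hardy_function g"
    unfolding g_def by (intro hardy_function_diff f hardy_function_const)
  note g' = hardy_functionD[OF g]
  have [measurable]: "g \<in> borel_measurable borel"
    using g'(1) by (simp cong: measurable_cong_sets)
  have "fourier_coeff g 0 = 0"
    using hardy_functionD(3)[OF f]
    by (simp add: g_def fourier_coeff_def circle.prob_space[unfolded space_circle])
  then have "fourier_coeff g n = 0" if "n \<le> 0" for n
    using g'(5)[of n] that by (cases "n = 0") auto
  moreover have "integrable circle (\<lambda>z. (norm ((z powi (- 1)) *\<^sub>C g z))\<^sup>2)"
  proof (rule Bochner_Integration.integrable_bound[OF g'(2)])
    show "AE z in circle. norm ((norm ((z powi (- 1)) *\<^sub>C g z))\<^sup>2) \<le> norm ((norm (g z))\<^sup>2)"
      using AE_circle by eventually_elim (simp add: norm_scaleC norm_inverse)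
  qed measurable
  moreover have "fourier_coeff (\<lambda>z. (z powi (- 1)) *\<^sub>C g z) n = fourier_coeff g (n + 1)" for n
    by (simp only: fourier_coeff_powi_scaleC[OF \<open>g \<in> borel_measurable borel\<close>] diff_minus_eq_add)
  ultimately have "hardy_function (\<lambda>z. (z powi (- 1)) *\<^sub>C g z)"
    unfolding hardy_function_def by auto
  then show ?thesis
    by (simp add: g_def)
qed

lift_definition backward_shift :: "'a :: separable_complex_hilbert hardy \<Rightarrow> 'a hardy"
  is "\<lambda>f z. (z powi (- 1)) *\<^sub>C (f z - fourier_coeff f 0)"
proof -
  fix f g :: "complex \<Rightarrow> 'a"
  assume rel: "hardy_rel f g"
  then have *: "hardy_function f" "hardy_function g" "AE z in circle. f z = g z"
    by (auto simp: hardy_rel_def)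
  have "AE z in circle. (z powi (- 1)) *\<^sub>C (f z - fourier_coeff f 0) =
      (z powi (- 1)) *\<^sub>C (g z - fourier_coeff g 0)"
    using *(3) unfolding fourier_coeff_cong_AE[OF rel] by eventually_elim simp
  then show "hardy_rel (\<lambda>z. (z powi (- 1)) *\<^sub>C (f z - fourier_coeff f 0))
      (\<lambda>z. (z powi (- 1)) *\<^sub>C (g z - fourier_coeff g 0))"
    unfolding hardy_rel_def using *(1,2) hardy_function_backward_shift by blast
qed

text \<open>Multiplication by z undoes division by z almost everywhere. This splitting of
  \<open>f\<close> into a multiple of z and a constant replaces Fourier series in all that
  follows.\<close>

lemma shift_backward_shift: "shift (backward_shift f) + const_hardy (coeff0 f) = f"
proof transfer
  fix f :: "complex \<Rightarrow> 'a" assume "hardy_rel f f"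
  then have f: "hardy_function f"
    by (simp add: hardy_rel_def)
  have "AE z in circle. z *\<^sub>C (z powi (- 1)) *\<^sub>C (f z - fourier_coeff f 0) + fourier_coeff f 0 = f z"
    using AE_circle
  proof eventually_elim
    case (elim z)
    then have "z \<noteq> 0" by auto
    then show ?case by (simp add: scaleC_scaleC power_int_minus)
  qed
  then show "hardy_rel (\<lambda>z. z *\<^sub>C (z powi (- 1)) *\<^sub>C (f z - fourier_coeff f 0) + fourier_coeff f 0) f"
    unfolding hardy_rel_def
    by (intro conjI hardy_function_add hardy_function_shift hardy_function_backward_shift
        hardy_function_const f)
qed

text \<open>A bounded functional passes through the integral. Being adjoint to each other,
  \<open>const_hardy\<close> and \<open>coeff0\<close> inherit additivity from the inner product,
  without a return to representatives.\<close>

lemma cinner_const_hardy: "cinner (const_hardy x) f = cinner x (coeff0 f)"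
proof transfer
  fix x and f :: "complex \<Rightarrow> 'a" assume "hardy_rel f f"
  then have "integrable circle f"
    by (auto simp: hardy_rel_def hardy_functionD)
  then show "(LINT z|circle. cinner x (f z)) = cinner x (fourier_coeff f 0)"
    unfolding fourier_coeff_def
    by (simp add: integral_bounded_linear[OF bounded_bilinear.bounded_linear_right[OF
            bounded_bilinear_cinner]])
qed

lemma coeff0_const_hardy: "coeff0 (const_hardy x) = x"
  by transfer (simp add: fourier_coeff_def circle.prob_space[unfolded space_circle])

lemma cinner_shift_shift: "cinner (shift f) (shift g) = cinner f g"
proof transfer
  fix f g :: "complex \<Rightarrow> 'a" assume "hardy_rel f f" "hardy_rel g g"
  then have [measurable]: "f \<in> borel_measurable borel" "g \<in> borel_measurable borel"
    by (auto simp: hardy_rel_def dest: hardy_functionD(1) cong: measurable_cong_sets)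
  show "(LINT z|circle. cinner (z *\<^sub>C f z) (z *\<^sub>C g z)) = (LINT z|circle. cinner (f z) (g z))"
  proof (rule integral_cong_AE)
    show "AE z in circle. cinner (z *\<^sub>C f z) (z *\<^sub>C g z) = cinner (f z) (g z)"
      using AE_circle
    proof eventually_elim
      case (elim z)
      then have "z * cnj z = 1"
        using complex_norm_square[of z] by simp
      then show ?case
        by (simp add: cinner_scaleC_left cinner_scaleC_right mult.assoc[symmetric] mult.commute)
    qed
  qed measurable
qed

text \<open>The zeroth coefficient of z f is the coefficient of \<open>f\<close> at -1, which
  vanishes for Hardy functions.\<close>

lemma coeff0_shift: "coeff0 (shift f) = 0"
proof transfer
  fix f :: "complex \<Rightarrow> 'a" assume "hardy_rel f f"
  then have f: "hardy_function f"
    by (simp add: hardy_rel_def)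
  then have "f \<in> borel_measurable borel"
    using hardy_functionD(1) by (auto cong: measurable_cong_sets)
  from fourier_coeff_powi_scaleC[OF this, of 1 0]
  show "fourier_coeff (\<lambda>z. z *\<^sub>C f z) 0 = 0"
    using hardy_functionD(5)[OF f, of "- 1"] by simp
qed

text \<open>Split \<open>g\<close> into its shifted part and its constant part: constants are
  orthogonal to the range of the shift, and the shift is isometric.\<close>

lemma cinner_shift: "cinner (shift f) g = cinner f (backward_shift g)"
proof -
  have "cinner (shift f) (const_hardy (coeff0 g)) = 0"
    by (subst cinner_commute) (simp add: cinner_const_hardy coeff0_shift)
  then show ?thesis
    using arg_cong[OF shift_backward_shift[of g], of "cinner (shift f)"]
    by (simp add: cinner_add_right cinner_shift_shift)
qed

lemma bounded_clinear_shift: "bounded_clinear shift"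
proof -
  have add: "shift (f + g) = shift f + shift g" for f g :: "'a hardy"
    by transfer
      (auto simp: hardy_rel_def scaleC_add_right intro!: hardy_function_add hardy_function_shift)
  have scale: "shift (c *\<^sub>C f) = c *\<^sub>C shift f" for c and f :: "'a hardy"
  proof transfer
    fix c and f :: "complex \<Rightarrow> 'a" assume "hardy_rel f f"
    then have "hardy_rel (\<lambda>z. c *\<^sub>C z *\<^sub>C f z) (\<lambda>z. c *\<^sub>C z *\<^sub>C f z)"
      by (intro hardy_rel_bounded_clinear[OF bounded_clinear_scaleC] hardy_rel_shift)
    then show "hardy_rel (\<lambda>z. z *\<^sub>C c *\<^sub>C f z) (\<lambda>z. c *\<^sub>C z *\<^sub>C f z)"
      by (simp add: scaleC_scaleC mult.commute)
  qed
  have "norm (shift f) = norm f" for f :: "'a hardy"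
    by (simp add: norm_eq_sqrt_inner inner_eq_Re_cinner cinner_shift_shift)
  then have "bounded_linear (shift :: 'a hardy \<Rightarrow> 'a hardy)"
    by (intro bounded_linear_intro[where K = 1]) (simp_all add: add scaleR_scaleC scale)
  then show ?thesis
    by (simp add: bounded_clinear_def scale)
qed

lemmas bounded_clinear_backward_shift = bounded_clinear_adjoint[OF bounded_clinear_shift cinner_shift]

lemma backward_shift_shift: "backward_shift (shift f) = f"
  by (rule cinner_right_eqI) (simp add: cinner_shift_shift flip: cinner_shift)

text \<open>The splitting of a constant has no shifted part, and the shift is injective because
  \<open>backward_shift\<close> is its left inverse.\<close>

lemma backward_shift_const_hardy: "backward_shift (const_hardy x) = 0"
proof -
  have "shift (backward_shift (const_hardy x)) = 0"
    using shift_backward_shift[of "const_hardy x"] by (simp add: coeff0_const_hardy)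
  then show ?thesis
    using backward_shift_shift bounded_clinear_zero[OF bounded_clinear_backward_shift] by metis
qed

lemma coeff0_add: "coeff0 (f + g) = coeff0 f + coeff0 g"
  by (rule cinner_right_eqI) (simp add: cinner_add_right flip: cinner_const_hardy)

lemma coeff0_diff: "coeff0 (f - g) = coeff0 f - coeff0 g"
  by (rule cinner_right_eqI) (simp add: cinner_diff_right flip: cinner_const_hardy)

lemma coeff0_zero: "coeff0 0 = 0"
  using coeff0_diff[of 0 0] by simp

section \<open>Pointwise application of an operator\<close>

lemma bounded_clinear_I_tensor:
  assumes X: "bounded_clinear X"
  shows "bounded_clinear (I_tensor X)"
proof -
  have add: "I_tensor X (f + g) = I_tensor X f + I_tensor X g" for f g
    using X
  proof transfer
    fix X :: "'a \<Rightarrow> 'a" and f g :: "complex \<Rightarrow> 'a"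
    assume X: "bounded_clinear X" and "hardy_rel f f" "hardy_rel g g"
    then have "hardy_rel (\<lambda>z. X (f z) + X (g z)) (\<lambda>z. X (f z) + X (g z))"
      by (intro hardy_rel_add hardy_rel_bounded_clinear[OF X])
    then show "hardy_rel (if bounded_clinear X then \<lambda>z. X (f z + g z) else (\<lambda>_. 0))
        (\<lambda>z. (if bounded_clinear X then \<lambda>z. X (f z) else (\<lambda>_. 0)) z +
          (if bounded_clinear X then \<lambda>z. X (g z) else (\<lambda>_. 0)) z)"
      using X by (simp add: bounded_clinear_add)
  qed
  have scale: "I_tensor X (c *\<^sub>C f) = c *\<^sub>C I_tensor X f" for c f
    using X
  proof transfer
    fix X :: "'a \<Rightarrow> 'a" and c and f :: "complex \<Rightarrow> 'a"
    assume X: "bounded_clinear X" and f: "hardy_rel f f"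
    then have "hardy_rel (\<lambda>z. c *\<^sub>C X (f z)) (\<lambda>z. c *\<^sub>C X (f z))"
      by (intro hardy_rel_bounded_clinear[OF bounded_clinear_scaleC] hardy_rel_bounded_clinear[OF X])
    then show "hardy_rel (if bounded_clinear X then \<lambda>z. X (c *\<^sub>C f z) else (\<lambda>_. 0))
        (\<lambda>z. c *\<^sub>C (if bounded_clinear X then \<lambda>z. X (f z) else (\<lambda>_. 0)) z)"
      using X by (simp add: bounded_clinear_def)
  qed
  obtain K where "K \<ge> 0" and K: "\<forall>x. norm (X x) \<le> norm x * K"
    using X bounded_linear.nonneg_bounded unfolding bounded_clinear_def by blast
  \<comment> \<open>Squared norms are integrals, so the pointwise bound is integrated in squared
    form; the root is taken afterwards, with \<open>K \<ge> 0\<close>.\<close>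
  have "Re (cinner (I_tensor X f) (I_tensor X f)) \<le> K\<^sup>2 * Re (cinner f f)" for f
    using X K
  proof transfer
    fix X :: "'a \<Rightarrow> 'a" and K and f :: "complex \<Rightarrow> 'a"
    assume X: "bounded_clinear X" and K: "\<forall>x. norm (X x) \<le> norm x * K" and "hardy_rel f f"
    then have f: "hardy_function f"
      by (simp add: hardy_rel_def)
    have "(LINT z|circle. (norm (X (f z)))\<^sup>2) \<le> (LINT z|circle. K\<^sup>2 * (norm (f z))\<^sup>2)"
    proof (rule integral_mono)
      show "(norm (X (f z)))\<^sup>2 \<le> K\<^sup>2 * (norm (f z))\<^sup>2" for z
        using power_mono[OF K[rule_format, of "f z"] norm_ge_zero, of 2]
        by (simp add: power_mult_distrib mult.commute)
    qed (use hardy_functionD(2)[OF f] hardy_functionD(2)[OF hardy_function_bounded_clinear[OF X f]]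
        in auto)
    then show "Re (LINT z|circle. cinner ((if bounded_clinear X then \<lambda>z. X (f z) else (\<lambda>_. 0)) z)
        ((if bounded_clinear X then \<lambda>z. X (f z) else (\<lambda>_. 0)) z))
      \<le> K\<^sup>2 * Re (LINT z|circle. cinner (f z) (f z))"
      using X by (simp add: cinner_self del: of_real_power)
  qed
  then have "norm (I_tensor X f) \<le> norm f * K" for f
    using \<open>K \<ge> 0\<close> real_sqrt_le_mono[of "Re (cinner (I_tensor X f) (I_tensor X f))" "K\<^sup>2 * Re (cinner f f)"]
    by (simp add: norm_eq_sqrt_inner inner_eq_Re_cinner real_sqrt_mult mult.commute)
  then have "bounded_linear (I_tensor X)"
    by (intro bounded_linear_intro[where K = K]) (simp_all add: add scaleR_scaleC scale)
  then show ?thesis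
    by (simp add: bounded_clinear_def scale)
qed

lemma I_tensor_shift:
  assumes X: "bounded_clinear X"
  shows "I_tensor X (shift f) = shift (I_tensor X f)"
  using X
proof transfer
  fix X :: "'a \<Rightarrow> 'a" and f :: "complex \<Rightarrow> 'a"
  assume X: "bounded_clinear X" and f: "hardy_rel f f"
  then have "hardy_rel (\<lambda>z. z *\<^sub>C X (f z)) (\<lambda>z. z *\<^sub>C X (f z))"
    by (intro hardy_rel_shift hardy_rel_bounded_clinear[OF X])
  then show "hardy_rel (if bounded_clinear X then \<lambda>z. X (z *\<^sub>C f z) else (\<lambda>_. 0))
      (\<lambda>z. z *\<^sub>C (if bounded_clinear X then \<lambda>z. X (f z) else (\<lambda>_. 0)) z)"
    using X by (simp add: bounded_clinear_def)
qed

lemma I_tensor_const_hardy: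
  assumes X: "bounded_clinear X"
  shows "I_tensor X (const_hardy x) = const_hardy (X x)"
  using X by transfer (simp add: hardy_rel_def hardy_function_const)

lemma coeff0_I_tensor:
  assumes X: "bounded_clinear X"
  shows "coeff0 (I_tensor X f) = X (coeff0 f)"
  using X
proof transfer
  fix X :: "'a \<Rightarrow> 'a" and f :: "complex \<Rightarrow> 'a"
  assume X: "bounded_clinear X" and "hardy_rel f f"
  then have "integrable circle f"
    by (auto simp: hardy_rel_def hardy_functionD)
  then show "fourier_coeff (if bounded_clinear X then \<lambda>z. X (f z) else (\<lambda>_. 0)) 0 = X (fourier_coeff f 0)"
    using X by (simp add: fourier_coeff_def integral_bounded_linear bounded_clinear_def)
qed

text \<open>\<open>I_tensor X\<close> commutes with the shift and sends constants to constants, so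
  it respects the splitting of \<open>f\<close>; the backward shift then removes the
  constant.\<close>

lemma I_tensor_backward_shift:
  assumes X: "bounded_clinear X"
  shows "I_tensor X (backward_shift f) = backward_shift (I_tensor X f)"
proof -
  note b = bounded_clinear_I_tensor[OF X] bounded_clinear_backward_shift
  have "backward_shift (I_tensor X f) =
      backward_shift (I_tensor X (shift (backward_shift f) + const_hardy (coeff0 f)))"
    by (simp add: shift_backward_shift)
  also have "\<dots> = I_tensor X (backward_shift f)"
    unfolding b[THEN bounded_clinear_add] I_tensor_shift[OF X] I_tensor_const_hardy[OF X]
    by (simp add: backward_shift_shift backward_shift_const_hardy)
  finally show ?thesis ..
qed

lemma cinner_I_tensor:
  assumes X: "bounded_clinear X" and Y: "bounded_clinear Y"
    and adj: "\<And>x y. cinner (X x) y = cinner x (Y y)"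
  shows "cinner (I_tensor X f) g = cinner f (I_tensor Y g)"
  using X Y adj by transfer simp

lemma I_tensor_comp:
  assumes X: "bounded_clinear X" and Y: "bounded_clinear Y"
  shows "I_tensor (X \<circ> Y) f = I_tensor X (I_tensor Y f)"
proof -
  have "bounded_clinear (X \<circ> Y)"
    using bounded_clinear_compose[OF X Y] by (simp add: comp_def)
  with X Y show ?thesis
  proof transfer
    fix X Y :: "'a \<Rightarrow> 'a" and f :: "complex \<Rightarrow> 'a"
    assume *: "bounded_clinear X" "bounded_clinear Y" "bounded_clinear (X \<circ> Y)" "hardy_rel f f"
    then have "hardy_rel (\<lambda>z. X (Y (f z))) (\<lambda>z. X (Y (f z)))"
      by (intro hardy_rel_bounded_clinear[of X] hardy_rel_bounded_clinear[of Y])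
    then show "hardy_rel (if bounded_clinear (X \<circ> Y) then \<lambda>z. (X \<circ> Y) (f z) else (\<lambda>_. 0))
        (if bounded_clinear X then
          \<lambda>z. X ((if bounded_clinear Y then \<lambda>z. Y (f z) else (\<lambda>_. 0)) z) else (\<lambda>_. 0))"
      using * by simp
  qed
qed

lemma I_tensor_difference:
  assumes X: "bounded_clinear X" and Y: "bounded_clinear Y"
  shows "I_tensor (\<lambda>x. X x - Y x) f = I_tensor X f - I_tensor Y f"
proof -
  \<comment> \<open>Addition on \<open>hardy\<close> is lifted, whereas subtraction is defined
    through multiplication by -1; hence the sum form for \<open>transfer\<close>.\<close>
  have "I_tensor (\<lambda>x. X x - Y x) f + I_tensor Y f = I_tensor X f"
    using X Y bounded_clinear_difference[OF X Y]
    by transfer (simp add: hardy_rel_def hardy_function_bounded_clinear)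
  then show ?thesis
    by (simp add: algebra_simps)
qed

lemma I_tensor_ident: "I_tensor (\<lambda>x. x) f = f"
proof -
  have *: "\<forall>x. X x = x \<Longrightarrow> bounded_clinear X \<Longrightarrow> I_tensor X f = f" for X :: "'a \<Rightarrow> 'a"
    by transfer simp
  show ?thesis
    by (rule *) (simp_all add: bounded_clinear_ident)
qed

section \<open>The pair attached to a BCL triple\<close>

lemma const_hardy_diff: "const_hardy (x - y) = const_hardy x - const_hardy y"
  by (rule cinner_left_eqI) (simp add: cinner_const_hardy cinner_diff_left)

lemma shift_backward_shift_eq: "shift (backward_shift f) = f - const_hardy (coeff0 f)"
  using shift_backward_shift[of f] by (metis add_diff_cancel_right')

context
  fixes U P :: "'a :: separable_complex_hilbert \<Rightarrow> 'a"
  assumes BCL: "BCL_triple U P"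
begin

lemma bounded_clinear_U: "bounded_clinear U"
  and bounded_clinear_P: "bounded_clinear P"
  and P_idem: "P (P x) = P x"
  and P_adj: "cinner (P x) y = cinner x (P y)"
  using BCL by (auto simp: BCL_triple_def unitary_def orthogonal_projection_def)

text \<open>The definite description in \<open>cadjoint\<close> needs a witness: since
  \<open>U\<close> is onto and preserves inner products, its inverse is one.\<close>

lemma U_adj: "cinner (U x) y = cinner x ((U\<^sup>\<dagger>) y)"
proof -
  have "surj U" and iso: "\<And>x y. cinner (U x) (U y) = cinner x y"
    using BCL by (auto simp: BCL_triple_def unitary_def)
  then have "cinner (U x) y = cinner x (inv U y)" for x y
    by (metis surj_f_inv_f)
  then show ?thesis
    by (simp add: cadjoint_eqI[of U "inv U"])
qed

lemma U_adj': "cinner ((U\<^sup>\<dagger>) x) y = cinner x (U y)"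
  by (metis U_adj cinner_commute)

lemma bounded_clinear_U_adj: "bounded_clinear (U\<^sup>\<dagger>)"
  by (rule bounded_clinear_adjoint[OF bounded_clinear_U U_adj])

lemma U_adj_U: "(U\<^sup>\<dagger>) (U x) = x"
proof (rule cinner_right_eqI)
  show "cinner z ((U\<^sup>\<dagger>) (U x)) = cinner z x" for z
    using BCL by (simp add: BCL_triple_def unitary_def flip: U_adj)
qed

lemma U_U_adj: "U ((U\<^sup>\<dagger>) y) = y"
proof -
  have "surj U"
    using BCL by (simp add: BCL_triple_def unitary_def)
  then obtain x where "y = U x"
    by blast
  then show ?thesis
    by (simp add: U_adj_U)
qed

section \<open>Calculation rules for coefficient operators and shifts\<close>

abbreviation (input) "u \<equiv> I_tensor U"
abbreviation (input) "u' \<equiv> I_tensor (U\<^sup>\<dagger>)"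
abbreviation (input) "p \<equiv> I_tensor P"

lemmas bounded_clinear_coeffs = bounded_clinear_U bounded_clinear_U_adj bounded_clinear_P

lemmas bounded_clinear_tensors = bounded_clinear_coeffs[THEN bounded_clinear_I_tensor]
  bounded_clinear_shift bounded_clinear_backward_shift

lemmas tensor_linear =
  bounded_clinear_tensors[THEN bounded_clinear_add] bounded_clinear_tensors[THEN bounded_clinear_diff]

lemma I_tensor_cancel:
  assumes "bounded_clinear X" "bounded_clinear Y" "\<And>x. X (Y x) = Z x"
  shows "I_tensor X (I_tensor Y f) = I_tensor Z f"
  using assms by (simp add: comp_def flip: I_tensor_comp)

lemma tensor_cancel: "u (u' f) = f" "u' (u f) = f" "p (p f) = p f"
  using I_tensor_cancel[OF bounded_clinear_U bounded_clinear_U_adj U_U_adj]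
    I_tensor_cancel[OF bounded_clinear_U_adj bounded_clinear_U U_adj_U]
    I_tensor_cancel[OF bounded_clinear_P bounded_clinear_P P_idem]
  by (simp_all add: I_tensor_ident)

text \<open>Oriented to move coefficient operators inside the shifts, where
  \<open>tensor_cancel\<close> can simplify them. Together with \<open>tensor_linear\<close> this
  settles the identities between products of the pair and its adjoints.\<close>

lemmas tensor_shift = bounded_clinear_coeffs[THEN I_tensor_shift]
  bounded_clinear_coeffs[THEN I_tensor_backward_shift]

lemma tensor_adj:
  "cinner (u f) g = cinner f (u' g)" "cinner (u' f) g = cinner f (u g)" "cinner (p f) g = cinner f (p g)"
  by (simp_all add: cinner_I_tensor bounded_clinear_coeffs U_adj U_adj' P_adj)

lemma I_tensor_perp: "I_tensor (P\<^sup>\<perp>) f = f - p f"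
  unfolding perp_def
  by (simp add: I_tensor_difference[OF bounded_clinear_ident bounded_clinear_P] I_tensor_ident)

lemma bounded_clinear_perp: "bounded_clinear (P\<^sup>\<perp>)"
  unfolding perp_def by (intro bounded_clinear_difference bounded_clinear_ident bounded_clinear_P)

section \<open>The pair and its adjoints in explicit form\<close>

lemma M_phi1_eq: "M_phi1 U P f = p (u' f) + shift (u' f - p (u' f))"
  by (simp add: M_phi1_def Sz_tensor_def I_tensor_comp bounded_clinear_coeffs bounded_clinear_perp
      I_tensor_perp)

lemma M_phi2_eq: "M_phi2 U P f = u (f - p f) + shift (u (p f))"
  by (simp add: M_phi2_def Sz_tensor_def I_tensor_comp bounded_clinear_coeffs bounded_clinear_perp
      I_tensor_perp)

lemma M_phi1_adj: "(M_phi1 U P)\<^sup>\<dagger> = (\<lambda>f. u (p f) + backward_shift (u (f - p f)))"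
  by (rule cadjoint_eqI)
    (simp add: M_phi1_eq cinner_add_left cinner_diff_left cinner_add_right cinner_diff_right
      cinner_shift tensor_adj tensor_linear tensor_shift)

lemma M_phi2_adj: "(M_phi2 U P)\<^sup>\<dagger> = (\<lambda>f. u' f - p (u' f) + backward_shift (p (u' f)))"
  by (rule cadjoint_eqI)
    (simp add: M_phi2_eq cinner_add_left cinner_diff_left cinner_add_right cinner_diff_right
      cinner_shift tensor_adj tensor_linear tensor_shift)

text \<open>\<open>M_phi2_adj\<close> only identifies the function named by \<open>cadjoint\<close>;
  the adjoint relation itself is recorded here for later use.\<close>

lemma cinner_M_phi2: "cinner (M_phi2 U P f) g = cinner f (((M_phi2 U P)\<^sup>\<dagger>) g)"
  by (simp add: M_phi2_eq M_phi2_adj cinner_add_left cinner_diff_left cinner_add_right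
      cinner_diff_right cinner_shift tensor_adj tensor_linear tensor_shift)

lemma bounded_clinear_M_phi:
  "bounded_clinear (M_phi1 U P)" "bounded_clinear (M_phi2 U P)"
  "bounded_clinear ((M_phi1 U P)\<^sup>\<dagger>)" "bounded_clinear ((M_phi2 U P)\<^sup>\<dagger>)"
  unfolding M_phi1_adj M_phi2_adj
  unfolding M_phi1_eq[abs_def] M_phi2_eq[abs_def]
  by (intro bounded_clinear_sum bounded_clinear_difference bounded_clinear_ident
      bounded_clinear_tensors bounded_clinear_tensors[THEN bounded_clinear_compose])+

section \<open>The operator H and its quadratic form\<close>

lemma bounded_clinear_H_op: "bounded_clinear (H_op (M_phi1 U P) (M_phi2 U P))"
  unfolding H_op_def comp_def
  by (intro bounded_clinear_sum bounded_clinear_difference bounded_clinear_ident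
      bounded_clinear_M_phi bounded_clinear_M_phi[THEN bounded_clinear_compose])

text \<open>The mixed terms vanish because \<open>P\<close> annihilates the range of
  \<open>P\<^sup>\<perp>\<close>. The other two give \<open>P\<close> and
  \<open>P\<^sup>\<perp>\<close>, the latter multiplied by shift times backward shift, which removes
  the constant term.\<close>

lemma M_phi1_M_phi1_adj:
  "M_phi1 U P (((M_phi1 U P)\<^sup>\<dagger>) f) = f - const_hardy (coeff0 f - P (coeff0 f))"
  by (simp add: M_phi1_eq M_phi1_adj tensor_linear tensor_shift tensor_cancel backward_shift_shift
      shift_backward_shift_eq coeff0_I_tensor bounded_clinear_coeffs const_hardy_diff)

lemma M_phi2_M_phi2_adj:
  "M_phi2 U P (((M_phi2 U P)\<^sup>\<dagger>) f) = f - const_hardy (U (P ((U\<^sup>\<dagger>) (coeff0 f))))"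
  by (simp add: M_phi2_eq M_phi2_adj tensor_linear tensor_shift tensor_cancel backward_shift_shift
      shift_backward_shift_eq coeff0_I_tensor bounded_clinear_coeffs const_hardy_diff)

lemma M_phi1_M_phi2: "M_phi1 U P (M_phi2 U P f) = shift f"
  by (simp add: M_phi1_eq M_phi2_eq tensor_linear tensor_shift tensor_cancel)

lemma M_phi1_adj_M_phi2_adj: "((M_phi1 U P)\<^sup>\<dagger>) (((M_phi2 U P)\<^sup>\<dagger>) f) = backward_shift f"
  by (simp add: M_phi1_adj M_phi2_adj tensor_linear tensor_shift tensor_cancel)

text \<open>Let E be the projection onto constants and \<open>Q = U P U\<^sup>\<dagger>\<close>. The
  four products are I - E Q, I - E \<open>P\<^sup>\<perp>\<close>, V2 (I - E Q) V2* and I - E. The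
  terms in I and the free E Q cancel, leaving V2 E Q V2* - E P.\<close>

lemma H_op_eq:
  "H_op (M_phi1 U P) (M_phi2 U P) f =
    M_phi2 U P (const_hardy (U (P ((U\<^sup>\<dagger>) (coeff0 (((M_phi2 U P)\<^sup>\<dagger>) f)))))) - const_hardy (P (coeff0 f))"
  by (simp add: H_op_def M_phi1_M_phi1_adj M_phi2_M_phi2_adj M_phi1_M_phi2 M_phi1_adj_M_phi2_adj
      bounded_clinear_diff[OF bounded_clinear_M_phi(2)] shift_backward_shift_eq const_hardy_diff)

lemma cinner_H_op:
  \<comment> \<open>This is the zeroth coefficient of the adjoint of \<open>M_phi2 U P\<close>
    applied to \<open>f\<close>; \<open>coeff0 (backward_shift f)\<close> is the Fourier coefficient
    of \<open>f\<close> at 1.\<close>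
  defines "c \<equiv> \<lambda>f. (P\<^sup>\<perp>) ((U\<^sup>\<dagger>) (coeff0 f)) + P ((U\<^sup>\<dagger>) (coeff0 (backward_shift f)))"
  shows "cinner (H_op (M_phi1 U P) (M_phi2 U P) f) f =
    cinner (U (P ((U\<^sup>\<dagger>) (c f)))) (c f) - cinner (P (coeff0 f)) (coeff0 f)"
proof -
  have "coeff0 (((M_phi2 U P)\<^sup>\<dagger>) f) = c f"
    by (simp add: c_def perp_def M_phi2_adj coeff0_add coeff0_diff coeff0_I_tensor
        bounded_clinear_coeffs flip: tensor_shift)
  then show ?thesis
    by (simp add: H_op_eq cinner_diff_left cinner_M_phi2 cinner_const_hardy)
qed

section \<open>Test vectors and the vanishing of P U P\<close>

lemma perp_adj: "cinner ((P\<^sup>\<perp>) x) y = cinner x ((P\<^sup>\<perp>) y)"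
  by (simp add: perp_def cinner_diff_left cinner_diff_right P_adj)

text \<open>For a constant the coefficient at 1 is zero, so only the \<open>P\<^sup>\<perp>\<close>
  part of \<open>c\<close> survives, and the form of H becomes that of A.\<close>

lemma cinner_H_op_const:
  "cinner (H_op (M_phi1 U P) (M_phi2 U P) (const_hardy s)) (const_hardy s) =
    cinner ((U \<circ> P\<^sup>\<perp> \<circ> U \<circ> P \<circ> U\<^sup>\<dagger> \<circ> P\<^sup>\<perp> \<circ> U\<^sup>\<dagger>) s - P s) s"
  by (simp add: cinner_H_op coeff0_const_hardy backward_shift_const_hardy coeff0_zero
      bounded_clinear_coeffs[THEN bounded_clinear_zero] cinner_diff_left U_adj perp_adj)

text \<open>At the vector \<open>U (P x)\<close> the first term of the form is zero, since
  \<open>P\<^sup>\<perp> U\<^sup>\<dagger> U P = 0\<close>. What remains is minus the squared norm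
  of \<open>P (U (P x))\<close>, so nonnegativity forces it to vanish.\<close>

lemma P_U_P_eq_0:
  assumes "\<And>s. 0 \<le> Re (cinner ((U \<circ> P\<^sup>\<perp> \<circ> U \<circ> P \<circ> U\<^sup>\<dagger> \<circ> P\<^sup>\<perp> \<circ> U\<^sup>\<dagger>) s - P s) s)"
  shows "P (U (P x)) = 0"
proof -
  have "(P\<^sup>\<perp>) ((U\<^sup>\<dagger>) (U (P x))) = 0"
    by (simp add: perp_def U_adj_U P_idem)
  then have "0 \<le> - Re (cinner (P (U (P x))) (U (P x)))"
    using assms[of "U (P x)"]
    by (simp add: bounded_clinear_coeffs[THEN bounded_clinear_zero]
        bounded_clinear_perp[THEN bounded_clinear_zero]
        cinner_diff_left[of 0, simplified])
  also have "cinner (P (U (P x))) (U (P x)) = cinner (P (U (P x))) (P (U (P x)))"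
    by (metis P_adj P_idem)
  finally show ?thesis
    unfolding cinner_self by simp
qed

lemma P_U_adj_P_eq_0:
  assumes "\<And>x. P (U (P x)) = 0"
  shows "P ((U\<^sup>\<dagger>) (P x)) = 0"
  by (rule cinner_right_eqI) (simp add: assms flip: P_adj U_adj)

end

section \<open>The equivalence\<close>

theorem proposition3p4:
  fixes U P A B D :: "'a :: separable_complex_hilbert \<Rightarrow> 'a"
  assumes "BCL_triple U P"
    and "A = (\<lambda>s. (U \<circ> P\<^sup>\<perp> \<circ> U \<circ> P \<circ> U\<^sup>\<dagger> \<circ> P\<^sup>\<perp> \<circ> U\<^sup>\<dagger>) s - P s)"
    and "B = U \<circ> P\<^sup>\<perp> \<circ> U \<circ> P \<circ> U\<^sup>\<dagger> \<circ> P \<circ> U\<^sup>\<dagger>"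
    and "D = U \<circ> P \<circ> U \<circ> P \<circ> U\<^sup>\<dagger> \<circ> P \<circ> U\<^sup>\<dagger>"
  shows "positive_operator (H_op (M_phi1 U P) (M_phi2 U P)) \<longleftrightarrow>
    positive_operator A \<and> positive_operator D \<and>
    (\<forall>s. (cmod (cinner (B s) s))\<^sup>2 \<le> Re (cinner (A s) s) * Re (cinner (D s) s))"
proof -
  note BCL = assms(1)
  let ?H = "H_op (M_phi1 U P) (M_phi2 U P)"
  note zero = bounded_clinear_coeffs[OF BCL, THEN bounded_clinear_zero]
    bounded_clinear_perp[OF BCL, THEN bounded_clinear_zero]
  have A: "bounded_clinear A"
    unfolding assms(2) comp_def
    by (intro bounded_clinear_difference bounded_clinear_coeffs[OF BCL]
        bounded_clinear_coeffs[OF BCL, THEN bounded_clinear_compose]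
        bounded_clinear_perp[OF BCL, THEN bounded_clinear_compose])
  have PUP: "P ((U\<^sup>\<dagger>) (P x)) = 0" if "positive_operator A" for x
  proof (intro P_U_adj_P_eq_0[OF BCL] P_U_P_eq_0[OF BCL])
    show "0 \<le> Re (cinner ((U \<circ> P\<^sup>\<perp> \<circ> U \<circ> P \<circ> U\<^sup>\<dagger> \<circ> P\<^sup>\<perp> \<circ> U\<^sup>\<dagger>) s - P s) s)" for s
      using that by (simp add: positive_operator_def assms(2) complex_nonneg_Reals_iff)
  qed
  show ?thesis
  proof
    assume "positive_operator ?H"
    then have "cinner (A s) s \<in> \<real>\<^sub>\<ge>\<^sub>0" for s
      unfolding positive_operator_def assms(2) cinner_H_op_const[OF BCL, symmetric] by blast
    then have pos: "positive_operator A"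
      using A by (simp add: positive_operator_def)
    \<comment> \<open>Both products contain the factor
      \<open>P \<circ> U\<^sup>\<dagger> \<circ> P\<close>; with B and D zero, the required
      inequality reads \<open>0 \<le> 0\<close>.\<close>
    have "B = (\<lambda>s. 0)" "D = (\<lambda>s. 0)"
      using PUP[OF pos] zero by (simp_all add: assms(3,4) fun_eq_iff)
    then show "positive_operator A \<and> positive_operator D \<and>
        (\<forall>s. (cmod (cinner (B s) s))\<^sup>2 \<le> Re (cinner (A s) s) * Re (cinner (D s) s))"
      using pos by (simp add: positive_operator_def bounded_clinear_def bounded_linear_zero
          scaleC_zero_right)
  next
    assume R: "positive_operator A \<and> positive_operator D \<and>
        (\<forall>s. (cmod (cinner (B s) s))\<^sup>2 \<le> Re (cinner (A s) s) * Re (cinner (D s) s))"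
    then have pos: "positive_operator A"
      by blast
    have "cinner (?H f) f = cinner (A (coeff0 f)) (coeff0 f)" for f
    proof -
      define s t where "s = (P\<^sup>\<perp>) ((U\<^sup>\<dagger>) (coeff0 f))"
        and "t = P ((U\<^sup>\<dagger>) (coeff0 (backward_shift f)))"
      \<comment> \<open>As \<open>t\<close> lies in the range of \<open>P\<close>, the contribution
        of the coefficient at 1 is annihilated by \<open>Q = U P U\<^sup>\<dagger>\<close>.\<close>
      have t: "P ((U\<^sup>\<dagger>) t) = 0"
        by (simp add: t_def PUP[OF pos])
      have st: "P ((U\<^sup>\<dagger>) (s + t)) = P ((U\<^sup>\<dagger>) s)"
        by (simp add: bounded_clinear_coeffs[OF BCL, THEN bounded_clinear_add] t)
      \<comment> \<open>Self-adjointness of Q moves it onto \<open>t\<close>, so the remaining cross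
        term vanishes too.\<close>
      have "cinner (U (P ((U\<^sup>\<dagger>) s))) t = cinner ((U\<^sup>\<dagger>) s) (P ((U\<^sup>\<dagger>) t))"
        by (simp add: U_adj[OF BCL] P_adj[OF BCL])
      then have "cinner (?H f) f = cinner (U (P ((U\<^sup>\<dagger>) s))) s - cinner (P (coeff0 f)) (coeff0 f)"
        unfolding cinner_H_op[OF BCL] s_def[symmetric] t_def[symmetric] st
        by (simp add: cinner_add_right t)
      then show ?thesis
        by (simp add: assms(2) cinner_diff_left U_adj[OF BCL] perp_adj[OF BCL] s_def)
    qed
    then show "positive_operator ?H"
      using pos bounded_clinear_H_op[OF BCL] by (simp add: positive_operator_def)
  qed
qed

end
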